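(* Let $a\colon\mathbb{N}\to\mathbb{Z}_{\ge0}$ and $b\colon\mathbb{N}\to\mathbb{C}$ be two $s$-functions such that $a(n)\ge1$ for every $n\in\mathbb{N}$ that is not squarefree, and let $c\colon\mathbb{N}\to\mathbb{C}$ be a bounded arithmetic function of invariant average $A$ under multiplications. Then $$\lim_{N\to\infty}\frac1N\sum_{\substack{1\le n\le N\\ (n,a(n))=1}}b(n)c(n)=\rho\cdot A,$$ where $$\rho=\frac6{\pi^2}\sum_{d=1}^\infty\frac{\mu(d)}{\sigma(d)}\sum_{\substack{f>1_{a(1)=0}\\ f\in\mathscr{F}\\ d\mid a(f)}}\frac{(d,f)\,b(f)}{\sigma_f}\prod_{p\mid(d,f)}\Big(1+\frac1p\Big).$$
   Context: $\mathbb{N}=\{1,2,3,\dots\}$; $(m,n)$ denotes the gcd, with $(n,0)=n$. $\mathscr{F}$ is the set of squarefull positive integers ($n$ is squarefull if $p^2\mid n$ for every prime $p\mid n$; $1\in\mathscr{F}$). Every $n\ge1$ is uniquely $n=qf$ with $q$ squarefree, $f\in\mathscr{F}$, $\gcd(q,f)=1$; $f=f(n)$ is the squarefull part of $n$. A function $a\colon\mathbb{N}\to\mathbb{C}$ is an $s$-function if $a(n)=a(f(n))$ for all $n\ge1$ and, for every $\varepsilon>0$, $a(n)\ll_\varepsilon n^\varepsilon$. A bounded function $c\colon\mathbb{N}\to\mathbb{C}$ is of invariant average $A$ under multiplications if $\lim_{N\to\infty}\frac1N\sum_{n=1}^N c(n)$ exists and equals $A$, and for every $d\in\mathbb{N}$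 the limit $\lim_{N\to\infty}\frac1N\sum_{n=1}^N c(dn)$ exists and equals $A$. $\mu$ is the Möbius function, $\sigma(n)=\sum_{d\mid n}d$, and $\sigma_f=f\prod_{p\mid f}(1+\frac1p)$. The symbol $1_{a(1)=0}$ equals $1$ if $a(1)=0$ and $0$ otherwise, so the inner sum runs over $f>1$ if $a(1)=0$ and over $f\ge1$ if $a(1)\ne0$. *)

theory Defs
  imports "HOL-Analysis.Analysis" "HOL-Computational_Algebra.Squarefree"
begin

text \<open>
  Arithmetic functions on the positive integers are functions on \<^typ>\<open>nat\<close>; every condition
  below only constrains their values at positive arguments, so the value at 0 is irrelevant.
\<close>

definition squarefull :: "nat \<Rightarrow> bool" where
  "squarefull n \<longleftrightarrow> n > 0 \<and> (\<forall>p. prime p \<longrightarrow> p dvd n \<longrightarrow> p ^ 2 dvd n)"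

text \<open>
  This is not the complement of \<open>squarefree_part\<close> from the library, which is the
  product of the primes of odd multiplicity.
\<close>

definition squarefull_part :: "nat \<Rightarrow> nat" where
  "squarefull_part n =
     (THE f. squarefull f \<and> (\<exists>q. squarefree q \<and> coprime q f \<and> n = q * f))"

lemma squarefull_decomposition_exists:
  "n > 0 \<Longrightarrow> \<exists>q f. squarefull f \<and> squarefree q \<and> coprime q f \<and> (n::nat) = q * f"
proof (induction n rule: less_induct)
  case (less n)
  show ?case
  proof (cases "n = 1")
    case True
    then show ?thesis by (intro exI[of _ 1]) (auto simp: squarefull_def)
  next
    case False
    then obtain p where p: "prime p" "p dvd n" using prime_factor_nat by blast
    define k where "k = multiplicity p n"
    have "n \<noteq> 0" "\<not> is_unit p" using less.prems p by auto
    then obtain m where m: "n = p ^ k * m" "\<not> p dvd m"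
      using multiplicity_decompose'[of n p] unfolding k_def by blast
    have k: "k > 0" using m p by (cases k) auto
    have "m > 0" using m less.prems by (cases m) auto
    moreover have "p ^ k > 1" using k p prime_gt_1_nat by (metis one_less_power)
    ultimately have "m < n" using m by simp
    from less.IH[OF this \<open>m > 0\<close>] obtain q f where
      qf: "squarefull f" "squarefree q" "coprime q f" "m = q * f" by blast
    have np: "\<not> p dvd q" "\<not> p dvd f" using m qf by auto
    have cop: "coprime p q" "coprime p f"
      using np p by (auto intro: prime_imp_coprime)
    show ?thesis
    proof (cases "k = 1")
      case True
      have "squarefree (p * q)"
        using cop p qf by (intro squarefree_mult_coprime) (auto intro: squarefree_prime)
      moreover have "coprime (p * q) f" using cop qf by simp
      ultimately show ?thesis using qf m True
        by (intro exI[of _ "p * q"] exI[of _ f]) auto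
    next
      case False
      have "squarefull (p ^ k * f)"
        unfolding squarefull_def
      proof (intro conjI allI impI)
        show "p ^ k * f > 0" using qf p by (auto simp: squarefull_def prime_gt_0_nat)
      next
        fix r assume r: "prime r" "r dvd p ^ k * f"
        then consider "r dvd p ^ k" | "r dvd f" by (auto simp: prime_dvd_mult_iff)
        then show "r ^ 2 dvd p ^ k * f"
        proof cases
          case 1
          then have "r = p" using r p by (meson prime_dvd_power primes_dvd_imp_eq)
          moreover have "p ^ 2 dvd p ^ k" using False k by (intro le_imp_power_dvd) linarith
          ultimately show ?thesis by (simp add: dvd_mult2)
        next
          case 2
          then show ?thesis using qf r by (auto simp: squarefull_def)
        qed
      qed
      moreover have "coprime q (p ^ k * f)"
        using cop qf by (simp add: coprime_commute)
      ultimately show ?thesis using qf m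
        by (intro exI[of _ q] exI[of _ "p ^ k * f"]) auto
    qed
  qed
qed

lemma squarefull_decomposition_dvd:
  assumes "squarefull f" "coprime q f" "squarefree q'" "coprime q' f'" "q * f = q' * (f'::nat)"
  shows "f dvd f'"
proof -
  have "coprime f q'"
  proof (rule ccontr)
    assume "\<not> coprime f q'"
    then obtain p where p: "prime p" "p dvd f" "p dvd q'"
      unfolding coprime_iff_gcd_eq_1 using prime_factor_nat[of "gcd f q'"] by auto
    have "p ^ 2 dvd q' * f'"
      using p assms(1) unfolding assms(5)[symmetric] by (simp add: squarefull_def)
    moreover have "coprime (p ^ 2) f'"
      using p assms(4) by (meson coprime_power_left_iff coprime_divisors dvd_refl)
    ultimately have "p ^ 2 dvd q'" by (simp add: coprime_dvd_mult_left_iff)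
    then have "p dvd 1" using assms(3) by (rule squarefreeD[rotated])
    then show False using p by simp
  qed
  moreover have "f dvd q' * f'" using assms(5) by (simp flip: assms(5))
  ultimately show ?thesis by (simp add: coprime_dvd_mult_right_iff)
qed

lemma squarefull_part_ex1:
  assumes "n > 0"
  shows "\<exists>!f. squarefull f \<and> (\<exists>q. squarefree q \<and> coprime q f \<and> n = q * f)"
proof (rule ex_ex1I)
  show "\<exists>f. squarefull f \<and> (\<exists>q. squarefree q \<and> coprime q f \<and> n = q * f)"
    using squarefull_decomposition_exists[OF assms] by blast
next
  fix f f'
  assume "squarefull f \<and> (\<exists>q. squarefree q \<and> coprime q f \<and> n = q * f)"
    and "squarefull f' \<and> (\<exists>q. squarefree q \<and> coprime q f' \<and> n = q * f')"
  then obtain q q' where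
    1: "squarefull f" "squarefree q" "coprime q f" "n = q * f" and
    2: "squarefull f'" "squarefree q'" "coprime q' f'" "n = q' * f'" by blast
  have "f dvd f'"
    by (rule squarefull_decomposition_dvd[of f q q' f']) (use 1 2 in simp_all)
  moreover have "f' dvd f"
    by (rule squarefull_decomposition_dvd[of f' q' q f]) (use 1 2 in simp_all)
  ultimately show "f = f'" by (rule dvd_antisym)
qed

definition s_function :: "(nat \<Rightarrow> complex) \<Rightarrow> bool" where
  "s_function a \<longleftrightarrow>
     (\<forall>n\<ge>1. a n = a (squarefull_part n)) \<and>
     (\<forall>\<epsilon>>0. \<exists>C. \<forall>n\<ge>1. norm (a n) \<le> C * real n powr \<epsilon>)"

definition invariant_average :: "(nat \<Rightarrow> complex) \<Rightarrow> complex \<Rightarrow> bool" where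
  "invariant_average c A \<longleftrightarrow>
     (\<exists>B. \<forall>n\<ge>1. norm (c n) \<le> B) \<and>
     (\<lambda>N. (\<Sum>n=1..N. c n) / of_nat N) \<longlonglongrightarrow> A \<and>
     (\<forall>d\<ge>1. (\<lambda>N. (\<Sum>n=1..N. c (d * n)) / of_nat N) \<longlonglongrightarrow> A)"

definition moebius_mu :: "nat \<Rightarrow> int" where
  "moebius_mu n = (if squarefree n then (-1) ^ card (prime_factors n) else 0)"

definition divisor_sum :: "nat \<Rightarrow> nat" where
  "divisor_sum n = (\<Sum>d | d dvd n. d)"

definition sigma_sub :: "nat \<Rightarrow> real" where
  "sigma_sub f = real f * (\<Prod>p\<in>prime_factors f. 1 + 1 / real p)"

definition rho_index :: "(nat \<Rightarrow> nat) \<Rightarrow> nat \<Rightarrow> nat set" where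
  "rho_index a d = {f. squarefull f \<and> f > of_bool (a 1 = 0) \<and> d dvd a f}"

definition rho_term :: "(nat \<Rightarrow> complex) \<Rightarrow> nat \<Rightarrow> nat \<Rightarrow> complex" where
  "rho_term b d f =
     of_nat (gcd d f) * b f / of_real (sigma_sub f) *
     of_real (\<Prod>p\<in>prime_factors (gcd d f). 1 + 1 / real p)"

definition rho_summand :: "(nat \<Rightarrow> nat) \<Rightarrow> (nat \<Rightarrow> complex) \<Rightarrow> nat \<Rightarrow> complex" where
  "rho_summand a b d =
     of_int (moebius_mu d) / of_nat (divisor_sum d) * (\<Sum>\<^sub>\<infinity>f\<in>rho_index a d. rho_term b d f)"

text \<open>The outer sum runs over \<open>d \<ge> 1\<close>, hence the shift by \<^const>\<open>Suc\<close>.\<close>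

definition rho :: "(nat \<Rightarrow> nat) \<Rightarrow> (nat \<Rightarrow> complex) \<Rightarrow> complex" where
  "rho a b = of_real (6 / pi\<^sup>2) * (\<Sum>d. rho_summand a b (Suc d))"

end

theory Submission
  imports Defs
begin

text \<open>
  Group the integers \<open>n = f q\<close> by their squarefull part \<open>f\<close>: the condition
  \<open>(n, a(n)) = 1\<close> says that \<open>(f, a(f)) = 1\<close> and that \<open>q\<close> is squarefree and coprime to
  \<open>k = f a(f)\<close>. Sieving finitely many pairwise coprime moduli \<open>m\<close> multiplies the mean of a
  dilation invariant \<open>c\<close> by \<open>\<Prod>(1 - 1/m)\<close>; taking the moduli \<open>p\<close> for \<open>p | k\<close> and \<open>p\<^sup>2\<close>
  otherwise, the mean of \<open>c(f q)\<close> over these \<open>q\<close> is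
  \<open>6/\<pi>\<^sup>2 A \<Prod>\<^bsub>p | k\<^esub> p/(p + 1)\<close>. Tannery's theorem sums this over \<open>f\<close>, since the squarefull
  numbers are so sparse that \<open>\<Sum> f\<^bsup>-3/4\<^esup>\<close> converges. Finally the condition \<open>(f, a(f)) = 1\<close> and
  the product over \<open>p | a(f)\<close> are together equal to
  \<open>\<Sum>\<^bsub>d | a(f)\<^esub> \<mu>(d) \<sigma>((d, f)) / \<sigma>(d)\<close>, and interchanging the two sums gives \<open>\<rho>\<close>.
\<close>

section \<open>Means along multiples and the sieve\<close>

definition has_mean :: "(nat \<Rightarrow> complex) \<Rightarrow> complex \<Rightarrow> bool" where
  "has_mean g L \<longleftrightarrow> (\<lambda>N. (\<Sum>n=1..N. g n) / of_nat N) \<longlonglongrightarrow> L"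

lemma div_over_self_tendsto:
  assumes "m > 0"
  shows "(\<lambda>N. of_nat (N div m) / of_nat N :: complex) \<longlonglongrightarrow> 1 / of_nat m"
proof -
  have "(\<lambda>N. real (N div m) / real N) \<longlonglongrightarrow> 1 / real m"
  proof (rule tendsto_sandwich)
    show "\<forall>\<^sub>F N in sequentially. 1 / real m - 1 / real N \<le> real (N div m) / real N"
    proof (rule eventually_sequentiallyI)
      fix N :: nat assume N: "N \<ge> 1"
      have "real N / real m - 1 \<le> real (N div m)"
        using floor_divide_of_nat_eq[of N m, where 'a = real] by linarith
      then have "(real N / real m - 1) / real N \<le> real (N div m) / real N"
        by (intro divide_right_mono) auto
      then show "1 / real m - 1 / real N \<le> real (N div m) / real N"
        using N by (simp add: diff_divide_distrib)
    qed
    show "\<forall>\<^sub>F N in sequentially. real (N div m) / real N \<le> 1 / real m"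
    proof (rule eventually_sequentiallyI)
      fix N :: nat assume N: "N \<ge> 1"
      have "real (N div m) / real N \<le> (real N / real m) / real N"
        by (intro divide_right_mono of_nat_div_le_of_nat) auto
      then show "real (N div m) / real N \<le> 1 / real m" using N by simp
    qed
    have "(\<lambda>N. 1 / real m - 1 / real N) \<longlonglongrightarrow> 1 / real m - 0"
      by (intro tendsto_diff tendsto_const lim_const_over_n)
    then show "(\<lambda>N. 1 / real m - 1 / real N) \<longlonglongrightarrow> 1 / real m" by simp
  qed auto
  then have "(\<lambda>N. complex_of_real (real (N div m) / real N)) \<longlonglongrightarrow> of_real (1 / real m)"
    by (rule tendsto_of_real)
  then show ?thesis by simp
qed

lemma has_mean_div:
  assumes "has_mean g L" "m > 0"
  shows "(\<lambda>N. (\<Sum>n=1..N div m. g n) / of_nat N) \<longlonglongrightarrow> L / of_nat m"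
proof -
  have "filterlim (\<lambda>N. N div m) sequentially sequentially"
    unfolding filterlim_at_top
  proof
    fix Z
    show "\<forall>\<^sub>F N in sequentially. Z \<le> N div m"
      using assms(2) by (intro eventually_sequentiallyI[of "Z * m"])
        (simp add: less_eq_div_iff_mult_less_eq)
  qed
  with assms(1) have "(\<lambda>N. (\<Sum>n=1..N div m. g n) / of_nat (N div m)) \<longlonglongrightarrow> L"
    unfolding has_mean_def by (rule filterlim_compose)
  from tendsto_mult[OF this div_over_self_tendsto[OF assms(2)]]
  have "(\<lambda>N. (\<Sum>n=1..N div m. g n) / of_nat (N div m) * (of_nat (N div m) / of_nat N))
          \<longlonglongrightarrow> L * (1 / of_nat m)" .
  \<comment> \<open>For \<open>N < m\<close> both sides vanish: the sum is empty, and division by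
    zero yields zero.\<close>
  moreover have "(\<Sum>n=1..N div m. g n) / of_nat (N div m) * (of_nat (N div m) / of_nat N) =
      (\<Sum>n=1..N div m. g n) / of_nat N" for N
    by (cases "N div m = 0") auto
  ultimately show ?thesis by (simp only: mult_1_right times_divide_eq_right)
qed

lemma has_mean_diff:
  "has_mean g L \<Longrightarrow> has_mean h K \<Longrightarrow> has_mean (\<lambda>n. g n - h n) (L - K)"
  unfolding has_mean_def sum_subtractf diff_divide_distrib by (rule tendsto_diff)

lemma sum_multiples:
  assumes "m > (0::nat)"
  shows "(\<Sum>n=1..N. if m dvd n then g n else 0) = (\<Sum>j=1..N div m. g (m * j) :: complex)"
proof -
  have "(\<Sum>n=1..N. if m dvd n then g n else 0) = sum g {n \<in> {1..N}. m dvd n}"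
    by (rule sum.inter_filter[symmetric]) simp
  also have "\<dots> = (\<Sum>j=1..N div m. g (m * j))"
    by (rule sum.reindex_bij_witness[of _ "\<lambda>j. m * j" "\<lambda>n. n div m"])
      (use assms in \<open>auto simp: less_eq_div_iff_mult_less_eq mult.commute div_le_mono
         elim!: dvdE\<close>)
  finally show ?thesis .
qed

lemma has_mean_multiples:
  assumes "has_mean (\<lambda>j. g (m * j)) L" "m > 0"
  shows "has_mean (\<lambda>n. if m dvd n then g n else 0) (L / of_nat m)"
  using has_mean_div[OF assms] unfolding has_mean_def sum_multiples[OF assms(2)] .

text \<open>This closure property drives the induction in the sieve and later allows
  \<open>c (f * q)\<close> to be averaged over \<open>q\<close> for fixed \<open>f\<close>.\<close>

lemma invariant_average_dilate:
  assumes "invariant_average c A" "m > 0"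
  shows "invariant_average (\<lambda>n. c (m * n)) A"
proof -
  from assms(1) obtain B where B: "\<And>n. n \<ge> 1 \<Longrightarrow> norm (c n) \<le> B"
    unfolding invariant_average_def by blast
  have lim: "(\<lambda>N. (\<Sum>n=1..N. c (d * n)) / of_nat N) \<longlonglongrightarrow> A" if "d \<ge> 1" for d
    using assms(1) that unfolding invariant_average_def by blast
  have "norm (c (m * n)) \<le> B" if "n \<ge> 1" for n
    using that assms(2) by (intro B) simp
  moreover have "(\<lambda>N. (\<Sum>n=1..N. c (m * (d * n))) / of_nat N) \<longlonglongrightarrow> A" if "d \<ge> 1" for d
    using lim[of "m * d"] that assms(2) by (simp add: mult.assoc)
  ultimately show ?thesis
    unfolding invariant_average_def using lim[of m] assms(2) by auto
qed

text \<open>Induction on \<open>M\<close> for all \<open>c\<close> at once. Removing the multiples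
  of a further \<open>m\<close> subtracts the mean of \<open>g c (m * j)\<close> over
  \<open>j\<close>, divided by \<open>m\<close>. By coprimality the factor \<open>m\<close> drops
  out of the conditions for the other moduli, and \<open>c (m * j)\<close> again has invariant
  average \<open>A\<close>. The induction hypothesis thus covers both terms, and their difference
  carries the new factor 1 - 1/m.\<close>

lemma has_mean_sieve:
  fixes M :: "nat set"
  assumes "finite M" "\<And>m. m \<in> M \<Longrightarrow> m > 0"
    and "\<And>m m'. m \<in> M \<Longrightarrow> m' \<in> M \<Longrightarrow> m \<noteq> m' \<Longrightarrow> coprime m m'"
    and "invariant_average c A"
  shows "has_mean (\<lambda>n. of_bool (\<forall>m\<in>M. \<not> m dvd n) * c n) (A * (\<Prod>m\<in>M. 1 - 1 / of_nat m))"
  using assms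
proof (induction M arbitrary: c rule: finite_induct)
  case empty
  then show ?case by (simp add: has_mean_def invariant_average_def)
next
  case (insert m M)
  define g where "g c' n = of_bool (\<forall>m\<in>M. \<not> m dvd n) * c' n" for c' :: "nat \<Rightarrow> complex" and n
  have IH: "has_mean (g c') (A * (\<Prod>m\<in>M. 1 - 1 / of_nat m))"
    if "invariant_average c' A" for c'
    using insert.IH[of c'] insert.prems that unfolding g_def by blast
  have m: "m > 0" using insert.prems by blast
  have cop: "coprime m' m" if "m' \<in> M" for m'
    using insert.prems(2)[of m' m] insert.hyps that by blast
  have "g c (m * j) = g (\<lambda>n. c (m * n)) j" for j
    unfolding g_def using cop by (simp add: coprime_dvd_mult_right_iff)
  then have "has_mean (\<lambda>j. g c (m * j)) (A * (\<Prod>m\<in>M. 1 - 1 / of_nat m))"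
    using IH[OF invariant_average_dilate[OF insert.prems(3) m]] by simp
  from has_mean_diff[OF IH[OF insert.prems(3)] has_mean_multiples[OF this m]]
  have "has_mean (\<lambda>n. g c n - (if m dvd n then g c n else 0))
      (A * (\<Prod>m\<in>M. 1 - 1 / of_nat m) - A * (\<Prod>m\<in>M. 1 - 1 / of_nat m) / of_nat m)" .
  moreover have "(\<lambda>n. g c n - (if m dvd n then g c n else 0)) =
      (\<lambda>n. of_bool (\<forall>m\<in>insert m M. \<not> m dvd n) * c n)"
    unfolding g_def by (rule ext) auto
  ultimately show ?case using insert.hyps by (simp add: algebra_simps)
qed

section \<open>The Euler product for zeta(2)\<close>

lemma has_sum_inverse_squares_sieve:
  fixes M :: "nat set"
  assumes "finite M" "\<And>p. p \<in> M \<Longrightarrow> prime p"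
  shows "((\<lambda>n. 1 / (real n)\<^sup>2) has_sum pi\<^sup>2 / 6 * (\<Prod>p\<in>M. 1 - 1 / (real p)\<^sup>2))
    {n. n > 0 \<and> (\<forall>p\<in>M. \<not> p dvd n)}"
  using assms
proof (induction M rule: finite_induct)
  case empty
  have "((\<lambda>n. 1 / (real n + 1)\<^sup>2) has_sum pi\<^sup>2 / 6) UNIV"
    using inverse_squares_sums by (intro sums_nonneg_imp_has_sum) (auto simp: add.commute)
  then have "((\<lambda>n. 1 / (real n)\<^sup>2) has_sum pi\<^sup>2 / 6) (range Suc)"
    by (subst has_sum_reindex) (auto simp: o_def add.commute)
  moreover have "range Suc = {n. n > 0}" by (auto simp: image_iff gr0_conv_Suc)
  ultimately show ?case by simp
next
  case (insert p M)
  \<comment> \<open>Multiplication by \<open>p\<close> maps \<open>S\<close> into itself, since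
    \<open>p\<close> is divisible by no prime in \<open>M\<close>, and it scales the sum by 1/p^2.
    Removing this image from \<open>S\<close> leaves exactly the members not divisible by
    \<open>p\<close>.\<close>
  define S where "S = {n. n > 0 \<and> (\<forall>p\<in>M. \<not> p dvd n)}"
  define z where "z = pi\<^sup>2 / 6 * (\<Prod>p\<in>M. 1 - 1 / (real p)\<^sup>2)"
  have p: "prime p" using insert.prems by blast
  have nd: "\<not> q dvd p" if "q \<in> M" for q
    using that insert.prems insert.hyps p primes_dvd_imp_eq by blast
  have 1: "((\<lambda>n. 1 / (real n)\<^sup>2) has_sum z) S"
    unfolding S_def z_def using insert by blast
  have "((\<lambda>n. 1 / (real p)\<^sup>2 * (1 / (real n)\<^sup>2)) has_sum 1 / (real p)\<^sup>2 * z) S"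
    by (rule has_sum_cmult_right[OF 1])
  then have 2: "((\<lambda>n. 1 / (real n)\<^sup>2) has_sum 1 / (real p)\<^sup>2 * z) ((*) p ` S)"
    using p by (subst has_sum_reindex)
      (auto simp: o_def power_mult_distrib inj_on_def prime_gt_0_nat)
  have "(*) p ` S \<subseteq> S"
    using p nd insert.prems by (auto simp: S_def prime_gt_0_nat prime_dvd_mult_iff)
  from has_sum_Diff[OF 1 2 this]
  have "((\<lambda>n. 1 / (real n)\<^sup>2) has_sum z - 1 / (real p)\<^sup>2 * z) (S - (*) p ` S)" .
  moreover have "S - (*) p ` S = {n. n > 0 \<and> (\<forall>p\<in>insert p M. \<not> p dvd n)}"
    using p by (fastforce simp: S_def image_iff prime_gt_0_nat elim!: dvdE[of p])
  ultimately show ?case using insert.hyps by (simp add: z_def algebra_simps)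
qed

text \<open>The sum of 1/n^2 over the n without prime factors up to \<open>T\<close> is pi^2/6 times
  the product. Every n > 1 is eventually excluded, so by Tannery's theorem with majorant 1/n^2 the
  sum tends to its term at n = 1.\<close>

lemma euler_product_zeta_2:
  "(\<lambda>T. \<Prod>p | prime p \<and> p \<le> T. 1 - 1 / (real p)\<^sup>2) \<longlonglongrightarrow> 6 / pi\<^sup>2"
proof -
  define P where "P T = {p::nat. prime p \<and> p \<le> T}" for T
  define u where "u n T = of_bool (n > 0 \<and> (\<forall>p\<in>P T. \<not> p dvd n)) * (1 / (real n)\<^sup>2)" for n T
  have sums: "(\<lambda>n. u n T) sums (pi\<^sup>2 / 6 * (\<Prod>p\<in>P T. 1 - 1 / (real p)\<^sup>2))" for T
  proof -
    have "((\<lambda>n. 1 / (real n)\<^sup>2) has_sum pi\<^sup>2 / 6 * (\<Prod>p\<in>P T. 1 - 1 / (real p)\<^sup>2))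
        {n. n > 0 \<and> (\<forall>p\<in>P T. \<not> p dvd n)}"
      by (rule has_sum_inverse_squares_sieve) (auto simp: P_def)
    then have "((\<lambda>n. u n T) has_sum (pi\<^sup>2 / 6 * (\<Prod>p\<in>P T. 1 - 1 / (real p)\<^sup>2))) UNIV"
      by (rule has_sum_cong_neutral[THEN iffD1, rotated -1]) (auto simp: u_def)
    then show ?thesis by (rule has_sum_imp_sums)
  qed
  have "(\<lambda>T. \<Sum>n. u n T) \<longlonglongrightarrow> (\<Sum>n. of_bool (n = 1))"
  proof (rule tannerys_theorem[THEN conjunct2, THEN conjunct2])
    fix n :: nat
    show "(\<lambda>T. u n T) \<longlonglongrightarrow> of_bool (n = 1)"
    proof (rule tendsto_eventually, rule eventually_sequentiallyI)
      fix T assume T: "T \<ge> n"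
      consider "n = 0" | "n = 1" | "n > 1" by linarith
      then show "u n T = of_bool (n = 1)"
      proof cases
        case 3
        then obtain p where "prime p" "p dvd n" using prime_factor_nat[of n] by auto
        moreover from this have "p \<le> T" using 3 T dvd_imp_le[of p n] by linarith
        ultimately show ?thesis using 3 by (auto simp: u_def P_def)
      qed (auto simp: u_def P_def)
    qed
  next
    show "\<forall>\<^sub>F (n, T) in sequentially \<times>\<^sub>F sequentially. norm (u n T) \<le> 1 / (real n)\<^sup>2"
      by (intro always_eventually) (auto simp: u_def)
    show "summable (\<lambda>n. 1 / (real n)\<^sup>2)"
      using inverse_power_summable[of 2, where 'a = real] by (simp add: inverse_eq_divide)
  qed simp
  also have "(\<Sum>n. of_bool (n = 1) :: real) = (\<Sum>n\<in>{1}. of_bool (n = (1::nat)))"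
    by (rule suminf_finite) auto
  finally have "(\<lambda>T. 6 / pi\<^sup>2 * (\<Sum>n. u n T)) \<longlonglongrightarrow> 6 / pi\<^sup>2 * 1"
    by (intro tendsto_mult_left) simp
  then show ?thesis by (simp add: sums_unique[OF sums, symmetric] P_def)
qed

section \<open>The mean over squarefree numbers coprime to k\<close>

text \<open>Serves to exchange the limits in \<open>T\<close> and \<open>N\<close>. The error bound
  is asked for only from \<open>T0\<close> on because the truncated sieve below is accurate only for
  \<open>T \<ge> k\<close>.\<close>

lemma tendsto_uniform_approximation:
  fixes x :: "nat \<Rightarrow> nat \<Rightarrow> 'a :: real_normed_vector"
  assumes "\<And>T. (\<lambda>N. x T N) \<longlonglongrightarrow> l T" "l \<longlonglongrightarrow> L" "\<epsilon> \<longlonglongrightarrow> 0"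
    and "\<And>T N. T \<ge> T0 \<Longrightarrow> norm (x T N - y N) \<le> \<epsilon> T"
  shows "y \<longlonglongrightarrow> L"
proof (rule LIMSEQ_I)
  fix e :: real assume e: "e > 0"
  have "\<forall>\<^sub>F T in sequentially. norm (l T - L) < e / 3"
    using assms(2) e by (intro order_tendstoD(2)[OF tendsto_norm_zero] LIM_zero) auto
  moreover have "\<forall>\<^sub>F T in sequentially. \<epsilon> T < e / 3"
    using assms(3) e by (intro order_tendstoD(2)) auto
  moreover have "\<forall>\<^sub>F T in sequentially. T \<ge> T0" by (rule eventually_ge_at_top)
  ultimately have "\<forall>\<^sub>F T in sequentially. norm (l T - L) < e / 3 \<and> \<epsilon> T < e / 3 \<and> T \<ge> T0"
    by eventually_elim auto
  then obtain T where T: "norm (l T - L) < e / 3" "\<epsilon> T < e / 3" "T \<ge> T0"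
    by (auto simp: eventually_sequentially)
  obtain N0 where N0: "\<And>N. N \<ge> N0 \<Longrightarrow> norm (x T N - l T) < e / 3"
    using LIMSEQ_D[OF assms(1)[of T], of "e / 3"] e by auto
  have "norm (y N - L) < e" if "N \<ge> N0" for N
  proof -
    have "y N - L = - (x T N - y N) + (x T N - l T) + (l T - L)" by simp
    also have "norm \<dots> \<le> norm (x T N - y N) + norm (x T N - l T) + norm (l T - L)"
      by (metis norm_minus_cancel norm_triangle_mono norm_triangle_ineq
          order_refl)
    also have "\<dots> < e" using assms(4)[OF T(3), of N] T N0[OF that] by linarith
    finally show ?thesis .
  qed
  then show "\<exists>N0. \<forall>N\<ge>N0. norm (y N - L) < e" by blast
qed

text \<open>Each m accounts for at most N/m^2 multiples of m^2, and 1/m^2 \<le> 1/(m-1) - 1/m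
  telescopes to at most 1/T over m > T. Counting with all integers \<open>p\<close> instead of
  primes only enlarges the set.\<close>

lemma card_divisible_by_large_square:
  assumes "T \<ge> 1"
  shows "real (card {n. 1 \<le> n \<and> n \<le> N \<and> (\<exists>p>T. p\<^sup>2 dvd n)}) \<le> real N / real T"
proof -
  have bound: "(\<Sum>m=T+1..T+j. 1 / (real m)\<^sup>2) \<le> 1 / real T - 1 / real (T + j)" for j
  proof (induction j)
    case (Suc j)
    have pos: "real (T + j) > 0" using assms by simp
    have "1 / (real (T + Suc j))\<^sup>2 \<le> 1 / (real (T + j) * real (T + Suc j))"
      using pos by (intro divide_left_mono) (auto simp: power2_eq_square intro!: mult_right_mono)
    also have "\<dots> = 1 / real (T + j) - 1 / real (T + Suc j)"
      using pos by (simp add: divide_simps)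
    finally show ?case using Suc by simp
  qed simp
  \<comment> \<open>The cutoff \<open>T+N\<close> loses nothing, as p \<le> p^2 k = n \<le>
    N.\<close>
  have "{n. 1 \<le> n \<and> n \<le> N \<and> (\<exists>p>T. p\<^sup>2 dvd n)} \<subseteq>
      (\<Union>m\<in>{T+1..T+N}. (*) (m\<^sup>2) ` {1..N div m\<^sup>2})"
  proof
    fix n assume "n \<in> {n. 1 \<le> n \<and> n \<le> N \<and> (\<exists>p>T. p\<^sup>2 dvd n)}"
    then obtain p k where n: "1 \<le> n" "n \<le> N" "T < p" "n = p\<^sup>2 * k" by (auto elim!: dvdE)
    have "p \<le> p\<^sup>2 * k"
      using n by (intro dvd_imp_le) (auto simp: power2_eq_square)
    then have "p \<in> {T+1..T+N}" using n by auto
    moreover have "k \<in> {1..N div p\<^sup>2}"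
      using n by (cases k) (auto simp: less_eq_div_iff_mult_less_eq mult.commute)
    ultimately show "n \<in> (\<Union>m\<in>{T+1..T+N}. (*) (m\<^sup>2) ` {1..N div m\<^sup>2})"
      using n(4) by blast
  qed
  then have "card {n. 1 \<le> n \<and> n \<le> N \<and> (\<exists>p>T. p\<^sup>2 dvd n)} \<le>
      card (\<Union>m\<in>{T+1..T+N}. (*) (m\<^sup>2) ` {1..N div m\<^sup>2})"
    by (intro card_mono) auto
  also have "\<dots> \<le> (\<Sum>m=T+1..T+N. card ((*) (m\<^sup>2) ` {1..N div m\<^sup>2}))"
    by (rule card_UN_le) simp
  also have "\<dots> \<le> (\<Sum>m=T+1..T+N. N div m\<^sup>2)"
    by (intro sum_mono order_trans[OF card_image_le]) auto
  finally have "real (card {n. 1 \<le> n \<and> n \<le> N \<and> (\<exists>p>T. p\<^sup>2 dvd n)}) \<le>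
      (\<Sum>m=T+1..T+N. real (N div m\<^sup>2))"
    by (simp flip: of_nat_sum)
  also have "\<dots> \<le> (\<Sum>m=T+1..T+N. real N * (1 / (real m)\<^sup>2))"
    using of_nat_div_le_of_nat[of N, where 'a = real]
    by (intro sum_mono) (metis mult.right_neutral of_nat_power times_divide_eq_right)
  also have "\<dots> = real N * (\<Sum>m=T+1..T+N. 1 / (real m)\<^sup>2)" by (simp add: sum_distrib_left)
  also have "\<dots> \<le> real N * (1 / real T)"
    using bound[of N] by (intro mult_left_mono) (auto intro: order_trans)
  finally show ?thesis by simp
qed

text \<open>For p dividing k, 1 - 1/p = (1 - 1/p^2) p/(p + 1). Since \<open>k \<le> T\<close> puts
  all prime factors of \<open>k\<close> into the product, the correction factor does not depend on
  \<open>T\<close>.\<close>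

lemma prod_prime_factor_densities:
  assumes "k > 0" "k \<le> T"
  shows "(\<Prod>p | prime p \<and> p \<le> T. 1 - 1 / of_nat (if p dvd k then p else p\<^sup>2)) =
    complex_of_real ((\<Prod>p | prime p \<and> p \<le> T. 1 - 1 / (real p)\<^sup>2) *
      (\<Prod>p\<in>prime_factors k. real p / (real p + 1)))"
proof -
  define P where "P = {p::nat. prime p \<and> p \<le> T}"
  have fin: "finite P" by (simp add: P_def)
  have sub: "prime_factors k = {p \<in> P. p dvd k}"
    using assms by (auto simp: P_def prime_factors_dvd dest: dvd_imp_le)
  have "(\<Prod>p\<in>P. 1 - 1 / of_nat (if p dvd k then p else p\<^sup>2)) =
      complex_of_real (\<Prod>p\<in>P. 1 - 1 / real (if p dvd k then p else p\<^sup>2))"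
    by simp
  also have "(\<Prod>p\<in>P. 1 - 1 / real (if p dvd k then p else p\<^sup>2)) =
      (\<Prod>p\<in>P. (1 - 1 / (real p)\<^sup>2) * (if p dvd k then real p / (real p + 1) else 1))"
  proof (rule prod.cong)
    fix p assume "p \<in> P"
    then have "real p > 1" using prime_gt_1_nat[of p] by (simp add: P_def)
    moreover have "(x\<^sup>2 - 1) * x = (x - 1) * x * (x + 1)" for x :: real
      by (simp add: algebra_simps power2_eq_square)
    ultimately show "1 - 1 / real (if p dvd k then p else p\<^sup>2) =
        (1 - 1 / (real p)\<^sup>2) * (if p dvd k then real p / (real p + 1) else 1)"
      by (auto simp: divide_simps power2_eq_square) (auto simp: algebra_simps)
  qed simp
  also have "\<dots> = (\<Prod>p\<in>P. 1 - 1 / (real p)\<^sup>2) * (\<Prod>p\<in>prime_factors k. real p / (real p + 1))"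
    unfolding prod.distrib sub using fin by (simp add: prod.inter_filter)
  finally show ?thesis by (simp add: P_def)
qed

text \<open>Sieve by the primes up to \<open>T\<close> and then let \<open>T\<close> grow. For
  \<open>T \<ge> k\<close> the truncated indicator can be wrong only at multiples of p^2 with p > T.
  These make up at most N/T of the n \<le> N, so the mean is off by at most B/T.\<close>

lemma has_mean_squarefree_coprime:
  assumes c: "invariant_average c A" and k: "k > 0"
  shows "has_mean (\<lambda>n. of_bool (squarefree n \<and> coprime n k) * c n)
    (A * of_real (6 / pi\<^sup>2 * (\<Prod>p\<in>prime_factors k. real p / (real p + 1))))"
proof -
  define P where "P T = {p::nat. prime p \<and> p \<le> T}" for T
  define w where "w p = (if p dvd k then p else p\<^sup>2)" for p
  have fin: "finite (P T)" for T by (simp add: P_def)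
  \<comment> \<open>The only prime divisor of \<open>w p\<close> is \<open>p\<close>, so distinct
    primes give distinct moduli and the product over the image of \<open>w\<close> can be reindexed
    by primes.\<close>
  have w_prime: "q dvd w p \<longleftrightarrow> q = p" if "prime p" "prime q" for p q
    using that by (auto simp: w_def dest: prime_dvd_power primes_dvd_imp_eq)
  have w_inj: "inj_on w (P T)" for T
    by (rule inj_onI) (metis P_def mem_Collect_eq w_prime)
  have w_pos: "w p > 0" if "prime p" for p
    using that by (simp add: w_def prime_gt_0_nat)
  have w_cop: "coprime (w p) (w q)" if "prime p" "prime q" "p \<noteq> q" for p q
    using that by (simp add: w_def primes_coprime)
  define g where "g n = of_bool (squarefree n \<and> coprime n k) * c n" for n
  define gT where "gT T n = of_bool (\<forall>m\<in>w ` P T. \<not> m dvd n) * c n" for T n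
  define l where "l T = A * (\<Prod>p\<in>P T. 1 - 1 / of_nat (w p))" for T
  obtain B where B: "\<And>n. n \<ge> 1 \<Longrightarrow> norm (c n) \<le> B"
    using c unfolding invariant_average_def by blast
  have B0: "B \<ge> 0" using B[of 1] norm_ge_zero[of "c 1"] by linarith
  have "has_mean (gT T) (l T)" for T
  proof -
    have "has_mean (gT T) (A * (\<Prod>m\<in>w ` P T. 1 - 1 / of_nat m))"
      unfolding gT_def
      by (rule has_mean_sieve[OF _ _ _ c])
        (use fin w_cop in \<open>auto simp: P_def w_pos prime_gt_0_nat\<close>)
    then show ?thesis by (simp add: l_def prod.reindex[OF w_inj] o_def)
  qed
  then have 1: "(\<lambda>N. (\<Sum>n=1..N. gT T n) / of_nat N) \<longlonglongrightarrow> l T" for T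
    by (simp add: has_mean_def)
  have 2: "l \<longlonglongrightarrow> A * of_real (6 / pi\<^sup>2 * (\<Prod>p\<in>prime_factors k. real p / (real p + 1)))"
  proof (rule Lim_transform_eventually)
    show "(\<lambda>T. A * of_real ((\<Prod>p\<in>P T. 1 - 1 / (real p)\<^sup>2) *
        (\<Prod>p\<in>prime_factors k. real p / (real p + 1)))) \<longlonglongrightarrow>
        A * of_real (6 / pi\<^sup>2 * (\<Prod>p\<in>prime_factors k. real p / (real p + 1)))"
      unfolding P_def
      by (intro tendsto_mult_left tendsto_of_real tendsto_mult_right euler_product_zeta_2)
    show "\<forall>\<^sub>F T in sequentially. A * of_real ((\<Prod>p\<in>P T. 1 - 1 / (real p)\<^sup>2) *
        (\<Prod>p\<in>prime_factors k. real p / (real p + 1))) = l T"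
      using prod_prime_factor_densities[OF k]
      by (intro eventually_sequentiallyI[of k]) (simp only: l_def w_def P_def)
  qed
  have agree: "gT T n = g n" if "T \<ge> k" "n \<ge> 1" "\<not> (\<exists>p>T. p\<^sup>2 dvd n)" for T n
  proof -
    have n0: "n \<noteq> 0" using that(2) by simp
    have "(\<forall>p\<in>P T. \<not> w p dvd n) \<longleftrightarrow> squarefree n \<and> coprime n k"
    proof safe
      assume *: "\<forall>p\<in>P T. \<not> w p dvd n"
      show "squarefree n"
      proof (rule ccontr)
        assume "\<not> squarefree n"
        then obtain p where p: "prime p" "p\<^sup>2 dvd n"
          using n0 squarefree_factorial_semiring[of n] by auto
        then have "p \<le> T" using that(3) by (meson not_le)
        then have "\<not> w p dvd n" using * p by (auto simp: P_def)
        moreover have "w p dvd p\<^sup>2" by (auto simp: w_def power2_eq_square)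
        ultimately show False using p(2) dvd_trans by blast
      qed
      show "coprime n k"
      proof (rule ccontr)
        assume "\<not> coprime n k"
        then obtain p where p: "prime p" "p dvd n" "p dvd k"
          unfolding coprime_iff_gcd_eq_1 using prime_factor_nat[of "gcd n k"] by auto
        then have "p \<le> T" using dvd_imp_le[OF p(3)] k that(1) by linarith
        then have "\<not> w p dvd n" using * p by (auto simp: P_def)
        then show False using p by (simp add: w_def)
      qed
    next
      fix p assume *: "squarefree n" "coprime n k" "p \<in> P T" "w p dvd n"
      then have p: "prime p" by (simp add: P_def)
      show False
      proof (cases "p dvd k")
        case True
        then have "p dvd 1" using * by (metis w_def coprime_common_divisor)
        then show False using p by simp
      next
        case False
        then have "p dvd 1" using * by (intro squarefreeD[of n]) (auto simp: w_def)
        then show False using p by simp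
      qed
    qed
    then show ?thesis by (simp add: gT_def g_def)
  qed
  have 3: "norm ((\<Sum>n=1..N. gT T n) / of_nat N - (\<Sum>n=1..N. g n) / of_nat N) \<le> B / real T"
    if T: "T \<ge> k" for T N
  proof -
    have T1: "T \<ge> 1" using T k by linarith
    define E where "E = {n. 1 \<le> n \<and> n \<le> N \<and> (\<exists>p>T. p\<^sup>2 dvd n)}"
    have "(\<Sum>n=1..N. gT T n) - (\<Sum>n=1..N. g n) = (\<Sum>n=1..N. gT T n - g n)"
      by (simp add: sum_subtractf)
    also have "\<dots> = (\<Sum>n\<in>E. gT T n - g n)"
      by (rule sum.mono_neutral_right) (use agree[OF T] in \<open>auto simp: E_def\<close>)
    also have "norm \<dots> \<le> (\<Sum>n\<in>E. B)"
    proof (rule sum_norm_le)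
      fix n assume "n \<in> E"
      then have "norm (c n) \<le> B" by (intro B) (auto simp: E_def)
      \<comment> \<open>Two indicators differ by at most 1 in absolute value, so \<open>B\<close>
        suffices here.\<close>
      then show "norm (gT T n - g n) \<le> B" using B0 by (auto simp: gT_def g_def)
    qed
    also have "\<dots> = B * real (card E)" by simp
    also have "\<dots> \<le> B * (real N / real T)"
      unfolding E_def by (intro mult_left_mono card_divisible_by_large_square T1 B0)
    finally have "norm ((\<Sum>n=1..N. gT T n) - (\<Sum>n=1..N. g n)) \<le> B * (real N / real T)" .
    then have "norm (((\<Sum>n=1..N. gT T n) - (\<Sum>n=1..N. g n)) / of_nat N) \<le>
        B * (real N / real T) / real N"
      unfolding norm_divide norm_of_nat by (rule divide_right_mono) simp
    also have "\<dots> \<le> B / real T" using B0 by (cases "N = 0") auto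
    finally show ?thesis by (simp add: diff_divide_distrib)
  qed
  have "(\<lambda>N. (\<Sum>n=1..N. g n) / of_nat N) \<longlonglongrightarrow>
      A * of_real (6 / pi\<^sup>2 * (\<Prod>p\<in>prime_factors k. real p / (real p + 1)))"
    by (rule tendsto_uniform_approximation[OF 1 2 lim_const_over_n[of B] 3])
  then show ?thesis by (simp add: has_mean_def g_def)
qed

section \<open>Summation over the squarefull part\<close>

text \<open>A prime of odd multiplicity in \<open>f\<close> occurs at least three times, so it also
  divides \<open>square_part f\<close>. Hence the squarefree part r divides the square part, and f =
  r (r x)^2 = x^2 r^3.\<close>

lemma squarefull_eq_square_times_cube:
  assumes "squarefull f"
  shows "\<exists>x y. f = x\<^sup>2 * y ^ 3"
proof -
  have f: "f \<noteq> 0" using assms by (auto simp: squarefull_def)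
  then have sq: "square_part f \<noteq> 0" by simp
  have "squarefree_part f dvd square_part f"
    unfolding prime_multiplicity_le_imp_dvd[OF squarefree_part_nonzero sq]
  proof (intro allI impI)
    fix p :: nat assume p: "prime p"
    have "multiplicity p f \<noteq> 1"
    proof
      assume 1: "multiplicity p f = 1"
      then have "p dvd f" using not_dvd_imp_multiplicity_0 by fastforce
      then have "p\<^sup>2 dvd f" using assms p by (auto simp: squarefull_def)
      then have "2 \<le> multiplicity p f"
        using f p by (intro multiplicity_geI) auto
      with 1 show False by simp
    qed
    then show "multiplicity p (squarefree_part f) \<le> multiplicity p (square_part f)"
      using p f by (simp add: prime_multiplicity_squarefree_part prime_multiplicity_square_part)
  qed
  then obtain x where "square_part f = squarefree_part f * x" by (elim dvdE)
  then have "f = x\<^sup>2 * squarefree_part f ^ 3"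
    by (subst squarefree_decompose[of f]) (simp add: power2_eq_square power3_eq_cube)
  then show ?thesis by blast
qed

text \<open>Choosing one representation x^2 y^3 for each \<open>f\<close> embeds the squarefull
  numbers into pairs. Over all pairs the series of x^(2s) y^(3s) factors, and both exponents are
  below -1.\<close>

lemma squarefull_powr_summable_on:
  assumes "s < - 1 / 2"
  shows "(\<lambda>f. real f powr s) summable_on {f. squarefull f}"
proof -
  define h where "h = (\<lambda>(x, y). (x::nat)\<^sup>2 * y ^ 3)"
  define \<phi> where "\<phi> = (\<lambda>(x, y). real x powr (2 * s) * real y powr (3 * s))"
  have sum: "(\<lambda>n. real n powr r) summable_on UNIV" if "r < - 1" for r
    using that by (subst summable_on_UNIV_nonneg_real_iff) (auto simp: summable_real_powr_iff)
  have "\<phi> summable_on (UNIV \<times> UNIV)"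
  proof (rule summable_on_SigmaI)
    fix x :: nat
    show "((\<lambda>y. \<phi> (x, y)) has_sum real x powr (2 * s) * (\<Sum>\<^sub>\<infinity>y. real y powr (3 * s))) UNIV"
      unfolding \<phi>_def prod.case
      using assms by (intro has_sum_cmult_right has_sum_infsum sum) simp
  next
    show "(\<lambda>x. real x powr (2 * s) * (\<Sum>\<^sub>\<infinity>y. real y powr (3 * s))) summable_on UNIV"
      using assms by (intro summable_on_cmult_left sum) simp
  qed (simp add: \<phi>_def)
  then have \<phi>: "\<phi> summable_on UNIV" by simp
  have "\<forall>f\<in>{f. squarefull f}. \<exists>z. h z = f"
    using squarefull_eq_square_times_cube by (fastforce simp: h_def)
  then obtain g where g: "\<And>f. squarefull f \<Longrightarrow> h (g f) = f"
    using bchoice[of "{f. squarefull f}" "\<lambda>f z. h z = f"] by blast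
  have "\<phi> summable_on (g ` {f. squarefull f})"
    by (rule summable_on_subset_banach[OF \<phi>]) simp
  moreover have "inj_on g {f. squarefull f}" by (rule inj_onI) (metis g mem_Collect_eq)
  ultimately have "(\<phi> \<circ> g) summable_on {f. squarefull f}" by (simp add: summable_on_reindex)
  moreover have "(\<phi> \<circ> g) f = real f powr s" if "squarefull f" for f
  proof -
    obtain x y where xy: "g f = (x, y)" by fastforce
    have f: "f = x\<^sup>2 * y ^ 3" using g[OF that] by (simp add: h_def xy)
    moreover have "f > 0" using that by (simp add: squarefull_def)
    ultimately have pos: "x > 0" "y > 0" by (auto intro: Nat.gr0I)
    have "real f = real x powr 2 * real y powr 3" using pos by (simp add: f powr_numeral)
    then have "real f powr s = (real x powr 2 * real y powr 3) powr s" by simp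
    also have "\<dots> = \<phi> (x, y)" using pos by (simp add: \<phi>_def powr_mult powr_powr del: powr_numeral)
    finally show ?thesis by (simp add: xy)
  qed
  ultimately show ?thesis
    using summable_on_cong[of "{f. squarefull f}" "\<phi> \<circ> g" "\<lambda>f. real f powr s"] by blast
qed

section \<open>Classes of integers with a given squarefull part\<close>

lemma squarefull_part_mult:
  assumes "squarefull f" "squarefree q" "coprime q f"
  shows "squarefull_part (f * q) = f"
  unfolding squarefull_part_def
proof (rule the1_equality[OF squarefull_part_ex1])
  show "f * q > 0" using assms by (auto simp: squarefull_def intro: Nat.gr0I)
  show "squarefull f \<and> (\<exists>q'. squarefree q' \<and> coprime q' f \<and> f * q = q' * f)"
    using assms by (auto simp: mult.commute)
qed

lemma s_function_mult:
  assumes "s_function b" "squarefull f" "squarefree q" "coprime q f"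
  shows "b (f * q) = b f"
proof -
  have "f * q \<ge> 1" using assms(2,3) by (cases "f * q") (auto simp: squarefull_def)
  then have "b (f * q) = b (squarefull_part (f * q))"
    using assms(1) unfolding s_function_def by blast
  then show ?thesis by (simp add: squarefull_part_mult assms)
qed

text \<open>
  The contribution of the \<open>n \<le> N\<close> with squarefull part \<open>f\<close>, and its mean for \<open>A = 1\<close> up to the
  factor \<open>6 / \<pi>\<^sup>2\<close>. If \<open>a(f) = 0\<close>, only \<open>n = f = 1\<close> contributes, whence mean \<open>0\<close>.
\<close>

definition class_sum ::
    "(nat \<Rightarrow> nat) \<Rightarrow> (nat \<Rightarrow> complex) \<Rightarrow> (nat \<Rightarrow> complex) \<Rightarrow> nat \<Rightarrow> nat \<Rightarrow> complex" where
  "class_sum a b c f N = (if squarefull f \<and> coprime f (a f)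
     then b f * (\<Sum>q=1..N div f. of_bool (squarefree q \<and> coprime q (f * a f)) * c (f * q))
     else 0)"

definition class_density :: "(nat \<Rightarrow> nat) \<Rightarrow> (nat \<Rightarrow> complex) \<Rightarrow> nat \<Rightarrow> complex" where
  "class_density a b f = (if squarefull f \<and> coprime f (a f) \<and> a f > 0
     then b f / of_real (sigma_sub f) * of_real (\<Prod>p\<in>prime_factors (a f). real p / (real p + 1))
     else 0)"

text \<open>Since \<open>a\<close> and \<open>b\<close> see only the squarefull part
  \<open>f\<close> of n = f q, coprimality of n and a(n) splits into \<open>coprime f (a f)\<close>
  and \<open>coprime q (a f)\<close>. The latter merges with \<open>coprime q f\<close> into
  coprimality of \<open>q\<close> to \<open>f * a f\<close>.\<close>

lemma sum_eq_sum_class_sum: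
  assumes "s_function (\<lambda>n. of_nat (a n))" "s_function b"
  shows "(\<Sum>n | 1 \<le> n \<and> n \<le> N \<and> gcd n (a n) = 1. b n * c n) = (\<Sum>f=1..N. class_sum a b c f N)"
proof -
  define F where "F = {f \<in> {1..N}. squarefull f \<and> coprime f (a f)}"
  define Q where "Q f = {q \<in> {1..N div f}. squarefree q \<and> coprime q (f * a f)}" for f
  have a: "a (f * q) = a f" if "squarefull f" "squarefree q" "coprime q f" for f q
    using s_function_mult[OF assms(1) that] by simp
  note b = s_function_mult[OF assms(2)]
  have "(\<Sum>f=1..N. class_sum a b c f N) =
      (\<Sum>f=1..N. if squarefull f \<and> coprime f (a f) then \<Sum>q\<in>Q f. b f * c (f * q) else 0)"
    unfolding class_sum_def Q_def sum.inter_filter[OF finite_atLeastAtMost] sum_distrib_left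
    by (intro sum.cong refl if_cong) auto
  also have "\<dots> = (\<Sum>f\<in>F. \<Sum>q\<in>Q f. b f * c (f * q))"
    unfolding F_def by (rule sum.inter_filter[symmetric]) simp
  also have "\<dots> = (\<Sum>(f, q)\<in>Sigma F Q. b f * c (f * q))"
    by (rule sum.Sigma) (auto simp: F_def Q_def)
  also have "\<dots> = (\<Sum>n | 1 \<le> n \<and> n \<le> N \<and> gcd n (a n) = 1. b n * c n)"
  proof (rule sum.reindex_bij_witness[of _ "\<lambda>n. (squarefull_part n, n div squarefull_part n)"
        "\<lambda>(f, q). f * q"])
    fix z assume "z \<in> Sigma F Q"
    then obtain f q where z: "z = (f, q)" "squarefull f" "f \<ge> 1" "coprime f (a f)"
      "q \<ge> 1" "q \<le> N div f" "squarefree q" "coprime q f" "coprime q (a f)"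
      by (auto simp: F_def Q_def)
    note sp = squarefull_part_mult[OF z(2) z(7) z(8)]
    show "(squarefull_part (case z of (f, q) \<Rightarrow> f * q),
        (case z of (f, q) \<Rightarrow> f * q) div squarefull_part (case z of (f, q) \<Rightarrow> f * q)) = z"
      using z(1,3) sp by simp
    have "f * q \<le> N" using z by (simp add: less_eq_div_iff_mult_less_eq mult.commute)
    then show "(case z of (f, q) \<Rightarrow> f * q) \<in> {n. 1 \<le> n \<and> n \<le> N \<and> gcd n (a n) = 1}"
      using z by (simp add: a Suc_le_eq flip: coprime_iff_gcd_eq_1)
    show "b (case z of (f, q) \<Rightarrow> f * q) * c (case z of (f, q) \<Rightarrow> f * q) =
        (case z of (f, q) \<Rightarrow> b f * c (f * q))"
      using z by (simp add: b)
  next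
    fix n assume n: "n \<in> {n. 1 \<le> n \<and> n \<le> N \<and> gcd n (a n) = 1}"
    then obtain f q where fq: "squarefull f" "squarefree q" "coprime q f" "n = f * q"
      using squarefull_decomposition_exists[of n] by (auto simp: mult.commute)
    note sp = squarefull_part_mult[OF fq(1,2,3)]
    have pos: "f > 0" "q > 0" using n fq(4) by (auto intro: Nat.gr0I)
    show "(case (squarefull_part n, n div squarefull_part n) of (f, q) \<Rightarrow> f * q) = n"
      using fq pos sp by simp
    have "coprime (f * q) (a f)" using n fq by (simp add: a coprime_iff_gcd_eq_1)
    moreover have "f \<le> N"
    proof -
      have "f * 1 \<le> f * q" using pos by (intro mult_le_mono2) simp
      moreover have "f * q \<le> N" using n fq(4) by simp
      ultimately show ?thesis by linarith
    qed
    moreover have "q \<le> N div f"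
      using n fq(4) pos by (simp add: less_eq_div_iff_mult_less_eq mult.commute)
    ultimately show "(squarefull_part n, n div squarefull_part n) \<in> Sigma F Q"
      using fq pos sp by (simp add: F_def Q_def Suc_le_eq)
  qed
  finally show ?thesis ..
qed

text \<open>If \<open>a f > 0\<close>, the preceding mean is applied to the dilate
  \<open>c (f * q)\<close> with k = \<open>f * a f\<close>, and the range \<open>N div f\<close>
  adds a factor 1/f. As \<open>f\<close> and \<open>a f\<close> are coprime, the prime product
  splits, and its part over p | f combines with 1/f to \<open>1 / sigma_sub f\<close>.\<close>

lemma class_sum_tendsto:
  assumes c: "invariant_average c A"
  shows "(\<lambda>N. class_sum a b c f N / of_nat N) \<longlonglongrightarrow>
    A * of_real (6 / pi\<^sup>2) * class_density a b f"
proof (cases "squarefull f \<and> coprime f (a f)")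
  case True
  then have f: "f > 0" by (simp add: squarefull_def)
  show ?thesis
  proof (cases "a f = 0")
    case zero: True
    with True have "f = 1" by simp
    \<comment> \<open>Only 1 is coprime to 0, so the class sum is constant for
      \<open>N \<ge> 1\<close> and its mean vanishes.\<close>
    have "(\<Sum>q=1..N. of_bool (squarefree q \<and> coprime q 0) * c q) = c 1" if "N \<ge> 1" for N
    proof -
      have "(\<Sum>q=1..N. of_bool (squarefree q \<and> coprime q 0) * c q) =
          (\<Sum>q\<in>{1}. of_bool (squarefree q \<and> coprime q 0) * c q)"
        using that by (intro sum.mono_neutral_right) auto
      then show ?thesis by simp
    qed
    then have "\<forall>\<^sub>F N in sequentially. b 1 * c 1 / of_nat N = class_sum a b c f N / of_nat N"
      using True zero unfolding class_sum_def
      by (intro eventually_sequentiallyI[of 1]) (simp add: \<open>f = 1\<close>)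
    moreover have "(\<lambda>N. b 1 * c 1 / of_nat N) \<longlonglongrightarrow> 0" by (rule lim_const_over_n)
    ultimately have "(\<lambda>N. class_sum a b c f N / of_nat N) \<longlonglongrightarrow> 0"
      by (rule Lim_transform_eventually[rotated])
    then show ?thesis using zero by (simp add: class_density_def)
  next
    case False
    define r where "r n = (\<Prod>p\<in>prime_factors n. real p / (real p + 1))" for n :: nat
    have "prime_factors (f * a f) = prime_factors f \<union> prime_factors (a f)"
      using f False by (simp add: prime_factors_product)
    moreover have "prime_factors f \<inter> prime_factors (a f) = {}"
        using True coprime_common_divisor[of f "a f"] not_prime_unit
      by (auto simp: in_prime_factors_iff)
    ultimately have r_mult: "r (f * a f) = r f * r (a f)"
      unfolding r_def by (simp only: prod.union_disjoint finite_set_mset)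
    define P where "P = (\<Prod>p\<in>prime_factors f. 1 + 1 / real p)"
    have "r f * P = (\<Prod>p\<in>prime_factors f. 1)"
      unfolding r_def P_def prod.distrib[symmetric]
    proof (intro prod.cong refl)
      fix p assume "p \<in> prime_factors f"
      then have "real p > 0" by (simp add: in_prime_factors_iff prime_gt_0_nat)
      moreover from this have "1 + 1 / real p = (real p + 1) / real p" by (simp add: field_simps)
      ultimately show "real p / (real p + 1) * (1 + 1 / real p) = 1" by simp
    qed
    then have "r f * P = 1" by simp
    moreover from this have "P \<noteq> 0" by auto
    ultimately have "r f = 1 / P" by (simp add: eq_divide_eq)
    then have sigma: "r f / real f = 1 / sigma_sub f"
      by (simp add: sigma_sub_def flip: P_def)
    have "f * a f > 0" using f False by simp
    from has_mean_div[OF has_mean_squarefree_coprime[OF invariant_average_dilate[OF c f] this] f]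
    have "(\<lambda>N. (\<Sum>q=1..N div f. of_bool (squarefree q \<and> coprime q (f * a f)) * c (f * q)) / of_nat N)
        \<longlonglongrightarrow> A * of_real (6 / pi\<^sup>2 * r (f * a f)) / of_nat f"
      unfolding r_def .
    then have "(\<lambda>N. b f * ((\<Sum>q=1..N div f. of_bool (squarefree q \<and> coprime q (f * a f)) * c (f * q)) / of_nat N))
        \<longlonglongrightarrow> b f * (A * of_real (6 / pi\<^sup>2 * r (f * a f)) / of_nat f)"
      by (rule tendsto_mult_left)
    also have "b f * (A * of_real (6 / pi\<^sup>2 * r (f * a f)) / of_nat f) =
        A * of_real (6 / pi\<^sup>2) * (b f * of_real (r f / real f) * of_real (r (a f)))"
      by (simp add: r_mult)
    also have "\<dots> = A * of_real (6 / pi\<^sup>2) * class_density a b f"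
      unfolding sigma using True False by (simp add: class_density_def r_def)
    finally show ?thesis
      using True by (simp only: class_sum_def if_True simp_thms times_divide_eq_right)
  qed
qed (auto simp: class_sum_def class_density_def)

text \<open>A bound independent of \<open>N\<close>, and summable over \<open>f\<close> when
  \<open>b\<close> is an s-function: the majorant for Tannery's theorem.\<close>

lemma norm_class_sum_le:
  assumes "\<And>n. n \<ge> 1 \<Longrightarrow> norm (c n) \<le> B"
  shows "norm (class_sum a b c f N / of_nat N) \<le> of_bool (squarefull f) * (B * (norm (b f) / real f))"
proof (cases "squarefull f \<and> coprime f (a f)")
  case True
  then have f: "f > 0" by (simp add: squarefull_def)
  have B0: "B \<ge> 0" using assms[of 1] norm_ge_zero[of "c 1"] by linarith
  have "norm (\<Sum>q=1..N div f. of_bool (squarefree q \<and> coprime q (f * a f)) * c (f * q)) \<le>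
      (\<Sum>q=1..N div f. B)"
    using f B0 assms by (intro sum_norm_le) (auto simp: Suc_le_eq)
  also have "\<dots> = B * real (N div f)" by simp
  also have "\<dots> \<le> B * (real N / real f)" using B0 by (intro mult_left_mono of_nat_div_le_of_nat)
  finally have "norm (class_sum a b c f N) \<le> norm (b f) * (B * (real N / real f))"
    using True by (simp only: class_sum_def if_True simp_thms norm_mult mult_left_mono norm_ge_zero)
  then have "norm (class_sum a b c f N) / real N \<le> norm (b f) * (B * (real N / real f)) / real N"
    by (rule divide_right_mono) simp
  also have "\<dots> \<le> B * (norm (b f) / real f)" using B0 by (cases "N = 0") (auto simp: mult.commute)
  finally show ?thesis using True by (simp add: norm_divide)
next
  case False
  have "B \<ge> 0" using assms[of 1] norm_ge_zero[of "c 1"] by linarith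
  then show ?thesis using False by (auto simp: class_sum_def)
qed

text \<open>Growth exponents 1/8 for both functions give terms of order f^(-3/4), and -3/4 < -1/2.
  The weight \<open>a\<close> is meant for the interchange of summation, where a(f) bounds the
  number of divisors of a(f).\<close>

lemma s_function_summable_on_squarefull:
  assumes "s_function b" "s_function a"
  shows "(\<lambda>f. norm (a f) * (norm (b f) / real f)) summable_on {f. squarefull f}"
proof -
  obtain C where C: "\<And>n. n \<ge> 1 \<Longrightarrow> norm (b n) \<le> C * real n powr (1 / 8)"
    using assms(1) unfolding s_function_def by (meson zero_less_divide_1_iff zero_less_numeral)
  obtain D where D: "\<And>n. n \<ge> 1 \<Longrightarrow> norm (a n) \<le> D * real n powr (1 / 8)"
    using assms(2) unfolding s_function_def by (meson zero_less_divide_1_iff zero_less_numeral)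
  have "(\<lambda>f. D * C * real f powr (- 3 / 4)) summable_on {f. squarefull f}"
    by (intro summable_on_cmult_right squarefull_powr_summable_on) simp
  then show ?thesis
  proof (rule summable_on_comparison_test)
    fix f assume "f \<in> {f. squarefull f}"
    then have f: "f \<ge> 1" by (simp add: squarefull_def)
    have "norm (a f) * (norm (b f) / real f) \<le>
        (D * real f powr (1 / 8)) * (C * real f powr (1 / 8) / real f)"
      using C[OF f] D[OF f] order_trans[OF norm_ge_zero D[OF f]]
      by (intro mult_mono divide_right_mono) auto
    also have "\<dots> = D * C * (real f powr (1 / 8) * real f powr (1 / 8) * real f powr (- 1))"
      using f powr_minus_divide[of "real f" 1] by simp
    also have "real f powr (1 / 8) * real f powr (1 / 8) * real f powr (- 1) =
        real f powr (- 3 / 4)"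
      unfolding powr_add[symmetric] by simp
    finally show "norm (a f) * (norm (b f) / real f) \<le> D * C * real f powr (- 3 / 4)" .
  qed simp
qed

lemma s_function_1: "s_function (\<lambda>n. 1)"
proof -
  have "\<exists>C. \<forall>n\<ge>1. norm (1 :: complex) \<le> C * real n powr \<epsilon>" if "\<epsilon> > 0" for \<epsilon>
    using that by (intro exI[of _ 1]) (auto intro: ge_one_powr_ge_zero)
  then show ?thesis by (simp add: s_function_def)
qed

lemma mean_tendsto_class_density:
  assumes "s_function (\<lambda>n. of_nat (a n))" "s_function b" "invariant_average c A"
  shows "(\<lambda>N. (\<Sum>n | 1 \<le> n \<and> n \<le> N \<and> gcd n (a n) = 1. b n * c n) / of_nat N) \<longlonglongrightarrow>
      (\<Sum>f. A * of_real (6 / pi\<^sup>2) * class_density a b f)"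
proof -
  obtain B where B: "\<And>n. n \<ge> 1 \<Longrightarrow> norm (c n) \<le> B"
    using assms(3) unfolding invariant_average_def by blast
  define M :: "nat \<Rightarrow> real"
    where "M f = of_bool (squarefull f) * (B * (norm (b f) / real f))" for f
  have "(\<lambda>f. norm (b f) / real f) summable_on {f. squarefull f}"
    using s_function_summable_on_squarefull[OF assms(2) s_function_1] by simp
  then have "(\<lambda>f. B * (norm (b f) / real f)) summable_on {f. squarefull f}"
    by (rule summable_on_cmult_right)
  then have "M summable_on UNIV"
    by (rule summable_on_cong_neutral[THEN iffD1, rotated -1]) (auto simp: M_def)
  then have M: "summable M" by (rule summable_on_imp_summable)
  have lim: "(\<lambda>N. \<Sum>f. class_sum a b c f N / of_nat N) \<longlonglongrightarrow>
      (\<Sum>f. A * of_real (6 / pi\<^sup>2) * class_density a b f)"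
    using tannerys_theorem[OF class_sum_tendsto[OF assms(3), of a b], where M = M] M
      norm_class_sum_le[of c B a b, OF B]
    by (simp_all add: always_eventually M_def)
  have "(\<Sum>f. class_sum a b c f N / of_nat N) =
      (\<Sum>n | 1 \<le> n \<and> n \<le> N \<and> gcd n (a n) = 1. b n * c n) / of_nat N" for N
  proof -
    \<comment> \<open>The series over \<open>f\<close> is a finite sum: 0 is not squarefull, and
      \<open>f > N\<close> leaves no \<open>q\<close>.\<close>
    have "class_sum a b c f N = 0" if "f \<notin> {1..N}" for f
    proof (cases "f = 0")
      case False
      with that have "N div f = 0" by simp
      then show ?thesis by (simp add: class_sum_def)
    qed (simp add: class_sum_def squarefull_def)
    then have "(\<Sum>f. class_sum a b c f N / of_nat N) = (\<Sum>f=1..N. class_sum a b c f N / of_nat N)"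
      by (intro suminf_finite) auto
    then show ?thesis
      by (simp only: sum_eq_sum_class_sum[OF assms(1,2)] sum_divide_distrib)
  qed
  with lim show "(\<lambda>N. (\<Sum>n | 1 \<le> n \<and> n \<le> N \<and> gcd n (a n) = 1. b n * c n) / of_nat N) \<longlonglongrightarrow>
      (\<Sum>f. A * of_real (6 / pi\<^sup>2) * class_density a b f)"
    by simp
qed

section \<open>Divisor sums\<close>

lemma prime_factors_prod_primes:
  fixes S :: "nat set"
  assumes "finite S" "\<And>p. p \<in> S \<Longrightarrow> prime p"
  shows "prime_factors (\<Prod>S) = S"
proof -
  have "prime_factors (\<Prod>S) = (\<Union>p\<in>S. prime_factors p)"
    using assms not_prime_0 by (subst prime_factors_prod) (auto simp del: not_prime_0)
  also have "\<dots> = S" using assms by (auto simp: prime_prime_factors)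
  finally show ?thesis .
qed

lemma prod_prime_factors_squarefree:
  fixes d :: nat
  assumes "squarefree d"
  shows "\<Prod>(prime_factors d) = d"
proof -
  have d: "d > 0" using assms by (auto intro: Nat.gr0I)
  have "\<Prod>(prime_factors d) = (\<Prod>p\<in>prime_factors d. p ^ multiplicity p d)"
  proof (rule prod.cong)
    fix p assume p: "p \<in> prime_factors d"
    then have "multiplicity p d = 1"
      using assms d squarefree_factorial_semiring'[of d] by (auto simp: in_prime_factors_iff)
    then show "p = p ^ multiplicity p d" by simp
  qed simp
  also have "\<dots> = d" using prime_factorization_nat[OF d] by simp
  finally show ?thesis .
qed

text \<open>A squarefree divisor is determined by its set of primes, and every set of primes
  dividing \<open>m\<close> occurs. Sums over such divisors thereby become expansions of products
  over the primes of \<open>m\<close>.\<close>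

lemma sum_squarefree_divisors:
  fixes m :: nat
  assumes "m > 0"
  shows "(\<Sum>d | d dvd m \<and> squarefree d. F (prime_factors d)) = (\<Sum>S\<in>Pow (prime_factors m). F S)"
proof (rule sum.reindex_bij_witness[of _ "\<lambda>S. \<Prod>S" prime_factors])
  fix S assume S: "S \<in> Pow (prime_factors m)"
  then have fin: "finite S" by (auto intro: finite_subset[of S "prime_factors m"])
  have pr: "\<And>p. p \<in> S \<Longrightarrow> prime p" using S by (auto simp: in_prime_factors_iff)
  show "prime_factors (\<Prod>S) = S" by (rule prime_factors_prod_primes[OF fin pr])
  have "squarefree (\<Prod>S)"
    using pr by (intro squarefree_prod_coprime) (auto simp: primes_coprime squarefree_prime)
  moreover have "\<Prod>S dvd m"
  proof -
    have "\<Prod>S dvd \<Prod>(prime_factors m)" using S by (intro prod_dvd_prod_subset) auto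
    also have "\<Prod>(prime_factors m) dvd (\<Prod>p\<in>prime_factors m. p ^ multiplicity p m)"
      by (intro prod_dvd_prod) (auto simp: prime_factors_multiplicity)
    also have "\<dots> = m" using prime_factorization_nat[OF assms] by simp
    finally show ?thesis .
  qed
  ultimately show "\<Prod>S \<in> {d. d dvd m \<and> squarefree d}" by simp
next
  fix d assume d: "d \<in> {d. d dvd m \<and> squarefree d}"
  then show "\<Prod>(prime_factors d) = d" by (simp add: prod_prime_factors_squarefree)
  show "prime_factors d \<in> Pow (prime_factors m)"
    using d assms dvd_prime_factors[of m d] by simp
qed simp

lemma divisor_sum_squarefree:
  assumes "squarefree d"
  shows "divisor_sum d = (\<Prod>p\<in>prime_factors d. p + 1)"
proof -
  have d: "d > 0" using assms by (auto intro: Nat.gr0I)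
  have "{e. e dvd d} = {e. e dvd d \<and> squarefree e}" using assms squarefree_mono by blast
  then have "divisor_sum d = (\<Sum>e | e dvd d \<and> squarefree e. \<Prod>(prime_factors e))"
    unfolding divisor_sum_def by (intro sum.cong) (auto simp: prod_prime_factors_squarefree)
  also have "\<dots> = (\<Sum>S\<in>Pow (prime_factors d). \<Prod>S)" by (rule sum_squarefree_divisors[OF d])
  also have "\<dots> = (\<Prod>p\<in>prime_factors d. p + 1)"
    by (simp only: prod_add finite_set_mset prod.neutral_const mult_1_right)
  finally show ?thesis .
qed

text \<open>For squarefree \<open>d\<close> the left side is \<mu>(d) \<sigma>((d, f)) /
  \<sigma>(d), and each \<sigma> is a product of factors p + 1. They cancel at the primes dividing
  \<open>f\<close>, leaving only the sign.\<close>

lemma moebius_divisor_sum_gcd: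
  assumes "f > 0" "squarefree d"
  shows "real_of_int (moebius_mu d) / real (divisor_sum d) *
      (real (gcd d f) * (\<Prod>p\<in>prime_factors (gcd d f). 1 + 1 / real p)) =
    (\<Prod>p\<in>prime_factors d. if p dvd f then - 1 else - (1 / (real p + 1)))"
proof -
  define D where "D = prime_factors d"
  have fin: "finite D" and pos: "\<And>p. p \<in> D \<Longrightarrow> p > 0"
    by (auto simp: D_def in_prime_factors_iff prime_gt_0_nat)
  have d: "d > 0" using assms by (auto intro: Nat.gr0I)
  have g: "prime_factors (gcd d f) = {p \<in> D. p dvd f}"
    using assms d by (auto simp: D_def prime_factors_dvd)
  have "squarefree (gcd d f)" using assms(2) by (rule squarefree_mono[rotated]) simp
  from prod_prime_factors_squarefree[OF this]
  have "real (gcd d f) = (\<Prod>p | p \<in> D \<and> p dvd f. real p)"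
    unfolding g of_nat_prod[symmetric] by simp
  then have "real (gcd d f) * (\<Prod>p\<in>prime_factors (gcd d f). 1 + 1 / real p) =
      (\<Prod>p | p \<in> D \<and> p dvd f. real p * (1 + 1 / real p))"
    by (simp add: g prod.distrib)
  also have "\<dots> = (\<Prod>p | p \<in> D \<and> p dvd f. real p + 1)"
    using pos by (intro prod.cong) (auto simp: field_simps)
  also have "\<dots> = (\<Prod>p\<in>D. if p dvd f then real p + 1 else 1)"
    using fin by (simp add: prod.inter_filter)
  finally have 1: "real (gcd d f) * (\<Prod>p\<in>prime_factors (gcd d f). 1 + 1 / real p) =
      (\<Prod>p\<in>D. if p dvd f then real p + 1 else 1)" .
  have 2: "real_of_int (moebius_mu d) = (\<Prod>p\<in>D. - 1)"
    using assms(2) by (simp add: moebius_mu_def D_def)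
  have 3: "real (divisor_sum d) = (\<Prod>p\<in>D. real p + 1)"
    by (simp add: divisor_sum_squarefree[OF assms(2)] D_def add.commute)
  show ?thesis
    unfolding 1 2 3 prod.distrib[symmetric] prod_dividef[symmetric] D_def[symmetric]
    by (intro prod.cong refl) (simp add: add_nonneg_eq_0_iff)
qed

text \<open>The divisor sum is the expansion of the product of \<open>1 + h p\<close> over p | m. A
  factor is 0 if p divides \<open>f\<close>, which enforces coprimality, and p/(p + 1)
  otherwise.\<close>

lemma sum_moebius_divisors:
  assumes "f > 0" "m > 0"
  shows "(\<Sum>d | d dvd m. real_of_int (moebius_mu d) / real (divisor_sum d) *
      (real (gcd d f) * (\<Prod>p\<in>prime_factors (gcd d f). 1 + 1 / real p))) =
    of_bool (coprime f m) * (\<Prod>p\<in>prime_factors m. real p / (real p + 1))"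
proof -
  define h where "h p = (if p dvd f then - 1 else - (1 / (real p + 1)))" for p
  have "(\<Sum>d | d dvd m. real_of_int (moebius_mu d) / real (divisor_sum d) *
      (real (gcd d f) * (\<Prod>p\<in>prime_factors (gcd d f). 1 + 1 / real p))) =
    (\<Sum>d | d dvd m \<and> squarefree d. real_of_int (moebius_mu d) / real (divisor_sum d) *
      (real (gcd d f) * (\<Prod>p\<in>prime_factors (gcd d f). 1 + 1 / real p)))"
    using assms(2) by (intro sum.mono_neutral_right) (auto simp: moebius_mu_def)
  also have "\<dots> = (\<Sum>d | d dvd m \<and> squarefree d. \<Prod>p\<in>prime_factors d. h p)"
    unfolding h_def by (intro sum.cong refl moebius_divisor_sum_gcd assms(1)) simp
  also have "\<dots> = (\<Sum>S\<in>Pow (prime_factors m). \<Prod>p\<in>S. h p)"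
    by (rule sum_squarefree_divisors[OF assms(2)])
  also have "\<dots> = (\<Prod>p\<in>prime_factors m. h p + 1)" by (simp add: prod_add)
  also have "\<dots> = of_bool (coprime f m) * (\<Prod>p\<in>prime_factors m. real p / (real p + 1))"
  proof (cases "coprime f m")
    case True
    have "h p + 1 = real p / (real p + 1)" if "p \<in> prime_factors m" for p
    proof -
      have p: "prime p" "p dvd m" using that by (auto simp: in_prime_factors_iff)
      then have "\<not> p dvd f" using coprime_common_divisor[OF True _ p(2)] not_prime_unit by blast
      moreover have "real p + 1 > 0" by simp
      ultimately show ?thesis by (simp add: h_def divide_simps)
    qed
    then show ?thesis using True by simp
  next
    case False
    then obtain p where "prime p" "p dvd f" "p dvd m"
      unfolding coprime_iff_gcd_eq_1 using prime_factor_nat[of "gcd f m"] by auto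
    then have "p \<in> prime_factors m" "h p + 1 = 0"
      using assms(2) by (auto simp: h_def in_prime_factors_iff)
    then have "(\<Prod>p\<in>prime_factors m. h p + 1) = 0" by (intro prod_zero) auto
    then show ?thesis using False by simp
  qed
  finally show ?thesis .
qed

section \<open>Bounds for the terms of rho\<close>

lemma norm_rho_term_le:
  assumes "f > 0"
  shows "norm (rho_term b d f) \<le> real (gcd d f) * (norm (b f) / real f)"
proof -
  define g where "g n = (\<Prod>p\<in>prime_factors n. 1 + 1 / real p)" for n :: nat
  have g: "g n \<ge> 1" for n unfolding g_def by (intro prod_ge_1) simp
  \<comment> \<open>The primes of the gcd are among those of \<open>f\<close>, and all factors are
    at least 1, so the prime product in \<open>rho_term\<close> is absorbed by the one in
    \<open>sigma_sub f\<close>.\<close>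
  have "g (gcd d f) \<le> g f"
    unfolding g_def using assms
    by (intro prod_mono2) (auto simp: in_prime_factors_iff intro: dvd_trans)
  then have "g (gcd d f) / g f \<le> 1" using g[of f] by simp
  then have "real (gcd d f) * (norm (b f) / real f) * (g (gcd d f) / g f) \<le>
      real (gcd d f) * (norm (b f) / real f) * 1"
    by (rule mult_left_mono) simp
  moreover have "norm (rho_term b d f) =
      real (gcd d f) * (norm (b f) / real f) * (g (gcd d f) / g f)"
    using g[of f] g[of "gcd d f"]
    by (simp add: rho_term_def sigma_sub_def norm_mult norm_divide abs_mult flip: g_def)
  ultimately show ?thesis by simp
qed

lemma rho_term_summable_on:
  assumes "s_function b" "d > 0"
  shows "rho_term b d summable_on rho_index a d"
proof -
  have "(\<lambda>f. norm (b f) / real f) summable_on {f. squarefull f}"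
    using s_function_summable_on_squarefull[OF assms(1) s_function_1] by simp
  then have "(\<lambda>f. real d * (norm (b f) / real f)) summable_on {f. squarefull f}"
    by (rule summable_on_cmult_right)
  then have "(\<lambda>f. real d * (norm (b f) / real f)) summable_on rho_index a d"
    by (rule summable_on_subset_banach) (auto simp: rho_index_def)
  then have "(\<lambda>f. norm (rho_term b d f)) summable_on rho_index a d"
  proof (rule Infinite_Sum.abs_summable_on_comparison_test')
    fix f assume "f \<in> rho_index a d"
    then have "f > 0" by (simp add: rho_index_def squarefull_def)
    then have "norm (rho_term b d f) \<le> real (gcd d f) * (norm (b f) / real f)"
      by (rule norm_rho_term_le)
    also have "\<dots> \<le> real d * (norm (b f) / real f)"
      using assms(2) by (intro mult_right_mono) auto
    finally show "norm (rho_term b d f) \<le> real d * (norm (b f) / real f)" .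
  qed
  then show ?thesis by (rule abs_summable_summable)
qed

section \<open>Interchange of summation\<close>

lemma sum_rho_term_divisors:
  assumes "squarefull f" "a f > 0"
  shows "(\<Sum>d | d dvd a f. of_int (moebius_mu d) / of_nat (divisor_sum d) * rho_term b d f) =
    class_density a b f"
proof -
  define s where "s d = real_of_int (moebius_mu d) / real (divisor_sum d) *
    (real (gcd d f) * (\<Prod>p\<in>prime_factors (gcd d f). 1 + 1 / real p))" for d
  have f: "f > 0" using assms(1) by (simp add: squarefull_def)
  have "of_int (moebius_mu d) / of_nat (divisor_sum d) * rho_term b d f =
      b f / of_real (sigma_sub f) * of_real (s d)" for d
    by (simp add: s_def rho_term_def mult_ac)
  then have "(\<Sum>d | d dvd a f. of_int (moebius_mu d) / of_nat (divisor_sum d) * rho_term b d f) =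
      b f / of_real (sigma_sub f) * of_real (\<Sum>d | d dvd a f. s d)"
    by (simp only: sum_distrib_left of_real_sum)
  also have "(\<Sum>d | d dvd a f. s d) =
      of_bool (coprime f (a f)) * (\<Prod>p\<in>prime_factors (a f). real p / (real p + 1))"
    unfolding s_def by (rule sum_moebius_divisors[OF f assms(2)])
  finally show ?thesis using assms by (simp add: class_density_def)
qed

text \<open>From (d, f) \<le> d \<le> \<sigma>(d) the weight cancels the gcd. The bound is uniform
  in \<open>d\<close>, which makes the double series absolutely convergent.\<close>

lemma norm_moebius_divisor_sum_rho_term_le:
  assumes "f > 0" "d > 0"
  shows "norm (of_int (moebius_mu d) / of_nat (divisor_sum d) * rho_term b d f) \<le>
    norm (b f) / real f"
proof -
  have "d \<le> divisor_sum d"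
    unfolding divisor_sum_def using assms(2) by (intro member_le_sum) auto
  then have sigma: "gcd d f \<le> divisor_sum d" "divisor_sum d > 0"
    using gcd_le1_nat[of d f] assms(2) by linarith+
  have mu: "norm (of_int (moebius_mu d) :: complex) \<le> 1" by (simp add: moebius_mu_def norm_power)
  have "norm (of_int (moebius_mu d) / of_nat (divisor_sum d) * rho_term b d f) \<le>
      1 / real (divisor_sum d) * (real (gcd d f) * (norm (b f) / real f))"
    unfolding norm_mult norm_divide norm_of_nat
    by (intro mult_mono divide_right_mono mu norm_rho_term_le assms(1)) auto
  also have "\<dots> = real (gcd d f) / real (divisor_sum d) * (norm (b f) / real f)" by simp
  also have "\<dots> \<le> 1 * (norm (b f) / real f)"
    using sigma by (intro mult_right_mono) auto
  finally show ?thesis by simp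
qed

text \<open>Fubini for an absolutely convergent double series over \<open>f\<close> in
  \<open>J\<close> and the divisors of \<open>a f\<close>. For fixed \<open>f\<close> there are at
  most \<open>a f\<close> divisors, so the norms sum to at most a(f) |b(f)| / f, which is summable
  over squarefull \<open>f\<close>. Summing first over \<open>d\<close> gives
  \<open>class_density\<close>, summing first over \<open>f\<close> gives
  \<open>rho_summand\<close>.\<close>

lemma sum_rho_summand:
  assumes "s_function (\<lambda>n. of_nat (a n))" "s_function b"
    and "\<And>n. n \<ge> 1 \<Longrightarrow> \<not> squarefree n \<Longrightarrow> a n \<ge> 1"
  shows "summable (\<lambda>d. rho_summand a b (Suc d))"
    and "summable (class_density a b)"
    and "(\<Sum>d. rho_summand a b (Suc d)) = (\<Sum>f. class_density a b f)"
proof -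
  define J where "J = {f. squarefull f \<and> a f > 0}"
  define u where "u d f = of_int (moebius_mu d) / of_nat (divisor_sum d) * rho_term b d f" for d f
  define t where "t f d = of_bool (Suc d dvd a f) * u (Suc d) f" for f d
  \<comment> \<open>A squarefull f > 1 is not squarefree, so \<open>a f > 0\<close> by hypothesis,
    and f = 1 is left out of \<open>rho_index\<close> exactly when \<open>a 1 = 0\<close>. Hence
    \<open>a f\<close> is positive for every index that occurs and has only finitely many
    divisors.\<close>
  have index: "rho_index a d = {f \<in> J. d dvd a f}" for d
  proof -
    have "a f > 0" if f: "squarefull f" "f > 1" for f
    proof -
      obtain p where p: "prime p" "p dvd f" using f(2) prime_factor_nat[of f] by auto
      then have "p\<^sup>2 dvd f" using f(1) p by (simp add: squarefull_def)
      then have "\<not> squarefree f" using p(1) by (intro not_squarefreeI[of p]) auto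
      then show ?thesis using assms(3)[of f] f(2) by simp
    qed
    moreover have "f = 1 \<or> f > 1" if "squarefull f" for f using that by (auto simp: squarefull_def)
    ultimately show ?thesis by (fastforce simp: rho_index_def J_def)
  qed
  have fin: "finite {d. Suc d dvd a f}" if "f \<in> J" for f
  proof (rule finite_subset)
    show "{d. Suc d dvd a f} \<subseteq> {..<a f}"
      using that by (auto simp: J_def dest!: dvd_imp_le)
  qed simp
  have t_abs: "(\<lambda>z. norm (case z of (f, d) \<Rightarrow> t f d)) summable_on J \<times> UNIV"
    unfolding Infinite_Sum.abs_summable_on_Sigma_iff prod.case
  proof (intro conjI ballI)
    fix f assume f: "f \<in> J"
    then show "(\<lambda>d. norm (t f d)) summable_on UNIV"
      by (intro finite_nonzero_values_imp_summable_on finite_subset[OF _ fin[OF f]])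
        (auto simp: t_def)
  next
    have "(\<lambda>f. norm (of_nat (a f) :: complex) * (norm (b f) / real f)) summable_on {f. squarefull f}"
      by (rule s_function_summable_on_squarefull[OF assms(2,1)])
    then have "(\<lambda>f. real (a f) * (norm (b f) / real f)) summable_on {f. squarefull f}" by simp
    then have "(\<lambda>f. real (a f) * (norm (b f) / real f)) summable_on J"
      by (rule summable_on_subset_banach) (auto simp: J_def)
    then show "(\<lambda>f. norm (\<Sum>\<^sub>\<infinity>d. norm (t f d))) summable_on J"
    proof (rule Infinite_Sum.abs_summable_on_comparison_test')
      fix f assume f: "f \<in> J"
      then have f0: "f > 0" "a f > 0" by (auto simp: J_def squarefull_def)
      have "(\<Sum>\<^sub>\<infinity>d. norm (t f d)) = (\<Sum>\<^sub>\<infinity>d\<in>{..<a f}. norm (t f d))"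
        using f0 by (intro infsum_cong_neutral) (auto simp: t_def dest!: dvd_imp_le)
      also have "\<dots> = (\<Sum>d<a f. norm (t f d))" by simp
      also have "\<dots> \<le> (\<Sum>d<a f. norm (b f) / real f)"
        using norm_moebius_divisor_sum_rho_term_le[OF f0(1)]
        by (intro sum_mono) (auto simp: t_def u_def)
      finally have "(\<Sum>\<^sub>\<infinity>d. norm (t f d)) \<le> real (a f) * (norm (b f) / real f)" by simp
      moreover have "(\<Sum>\<^sub>\<infinity>d. norm (t f d)) \<ge> 0" by (rule infsum_nonneg) simp
      ultimately show "norm (\<Sum>\<^sub>\<infinity>d. norm (t f d)) \<le> real (a f) * (norm (b f) / real f)" by simp
    qed
  qed
  then have t: "(\<lambda>(f, d). t f d) summable_on J \<times> UNIV" by (rule abs_summable_summable)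
  then have t': "(\<lambda>(d, f). t f d) summable_on UNIV \<times> J"
    by (subst summable_on_swap) (simp add: case_prod_unfold)
  have inner_d: "(\<Sum>\<^sub>\<infinity>d. t f d) = class_density a b f" if f: "f \<in> J" for f
  proof -
    have "(\<Sum>\<^sub>\<infinity>d. t f d) = (\<Sum>\<^sub>\<infinity>d\<in>{d. Suc d dvd a f}. u (Suc d) f)"
      by (rule infsum_cong_neutral) (auto simp: t_def)
    also have "\<dots> = (\<Sum>d | Suc d dvd a f. u (Suc d) f)" using fin[OF f] by simp
    also have "\<dots> = (\<Sum>d | d dvd a f. u d f)"
    proof (rule sum.reindex_bij_witness[of _ "\<lambda>d. d - 1" Suc])
      fix d assume "d \<in> {d. d dvd a f}"
      then show "Suc (d - 1) = d" "d - 1 \<in> {d. Suc d dvd a f}"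
        using f by (cases d; simp add: J_def)+
    qed auto
    finally show ?thesis using f sum_rho_term_divisors[of f a b] by (simp add: u_def J_def)
  qed
  have inner_f: "(\<Sum>\<^sub>\<infinity>f\<in>J. t f d) = rho_summand a b (Suc d)" for d
  proof -
    have "(\<Sum>\<^sub>\<infinity>f\<in>J. t f d) = (\<Sum>\<^sub>\<infinity>f\<in>rho_index a (Suc d). u (Suc d) f)"
      by (rule infsum_cong_neutral) (auto simp: t_def index)
    then show ?thesis unfolding u_def infsum_cmult_right' rho_summand_def .
  qed
  have "(\<lambda>f. \<Sum>\<^sub>\<infinity>d. t f d) summable_on J"
    using summable_on_Sigma_banach[OF t] by simp
  then have "class_density a b summable_on J"
    by (rule summable_on_cong[THEN iffD1, rotated]) (rule inner_d)
  then have density: "class_density a b summable_on UNIV"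
    by (rule summable_on_cong_neutral[THEN iffD1, rotated -1])
      (auto simp: J_def class_density_def)
  then show "summable (class_density a b)" by (rule summable_on_imp_summable)
  have "(\<lambda>d. \<Sum>\<^sub>\<infinity>f\<in>J. t f d) summable_on UNIV"
    using summable_on_Sigma_banach[OF t'] by simp
  then have summand: "(\<lambda>d. rho_summand a b (Suc d)) summable_on UNIV"
    by (simp add: inner_f)
  then show "summable (\<lambda>d. rho_summand a b (Suc d))" by (rule summable_on_imp_summable)
  have "(\<Sum>\<^sub>\<infinity>d. rho_summand a b (Suc d)) = (\<Sum>\<^sub>\<infinity>d. \<Sum>\<^sub>\<infinity>f\<in>J. t f d)"
    by (simp add: inner_f)
  also have "\<dots> = (\<Sum>\<^sub>\<infinity>f\<in>J. \<Sum>\<^sub>\<infinity>d. t f d)"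
    by (rule infsum_swap_banach[OF t, symmetric])
  also have "\<dots> = (\<Sum>\<^sub>\<infinity>f. class_density a b f)"
    by (rule infsum_cong_neutral) (auto simp: inner_d J_def class_density_def)
  finally have "(\<Sum>\<^sub>\<infinity>d. rho_summand a b (Suc d)) = (\<Sum>\<^sub>\<infinity>f. class_density a b f)" .
  \<comment> \<open>Since both families are summable, their unordered sums agree with the ordered
    series.\<close>
  then show "(\<Sum>d. rho_summand a b (Suc d)) = (\<Sum>f. class_density a b f)"
    using sums_unique[OF has_sum_imp_sums[OF has_sum_infsum[OF summand]]]
      sums_unique[OF has_sum_imp_sums[OF has_sum_infsum[OF density]]] by simp
qed

text \<open>Convergence of the inner and outer sums belongs to the conclusion because
  \<open>infsum\<close> and \<open>suminf\<close> are total and would assign a value to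
  \<open>rho\<close> even without it.\<close>

theorem theorem4p1:
  fixes a :: "nat \<Rightarrow> nat" and b c :: "nat \<Rightarrow> complex" and A :: complex
  assumes "s_function (\<lambda>n. of_nat (a n))"
    and "s_function b"
    and "\<And>n. n \<ge> 1 \<Longrightarrow> \<not> squarefree n \<Longrightarrow> a n \<ge> 1"
    and "invariant_average c A"
  shows "(\<forall>d\<ge>1. rho_term b d summable_on rho_index a d) \<and>
         summable (\<lambda>d. rho_summand a b (Suc d)) \<and>
         (\<lambda>N. (\<Sum>n | 1 \<le> n \<and> n \<le> N \<and> gcd n (a n) = 1. b n * c n) / of_nat N)
           \<longlonglongrightarrow> rho a b * A"
proof (intro conjI allI impI)
  fix d :: nat assume "d \<ge> 1"
  then show "rho_term b d summable_on rho_index a d"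
    by (intro rho_term_summable_on assms(2)) simp
next
  note S = sum_rho_summand[OF assms(1,2,3)]
  show "summable (\<lambda>d. rho_summand a b (Suc d))" by (rule S(1))
  have "rho a b * A = A * of_real (6 / pi\<^sup>2) * (\<Sum>f. class_density a b f)"
    by (simp add: rho_def S(3) mult.commute)
  also have "\<dots> = (\<Sum>f. A * of_real (6 / pi\<^sup>2) * class_density a b f)"
    by (rule suminf_mult[OF S(2), symmetric])
  finally show "(\<lambda>N. (\<Sum>n | 1 \<le> n \<and> n \<le> N \<and> gcd n (a n) = 1. b n * c n) / of_nat N)
      \<longlonglongrightarrow> rho a b * A"
    using mean_tendsto_class_density[OF assms(1,2,4)] by simp
qed

end
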